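(* Let $p$ be a selective ultrafilter on $\omega$. Then $\mathscr G^p$ is a cancellative subsemigroup of $(\beta\omega,+)$: for all $u,v,w\in\mathscr G^p$, $u+w=v+w$ implies $u=v$, and $u+v=u+w$ implies $v=w$.
   Context: For $u,v\in\beta\omega$, $u+v=\{A\subseteq\omega : \{x : \{y : x+y\in A\}\in v\}\in u\}$. A nonprincipal ultrafilter $p$ on $\omega$ is selective if for every partition $\omega=\bigcup_n X_n$ either some $X_n\in p$ or there is $A\in p$ with $|A\cap X_n|\le1$ for all $n$. $p\text{-}\lim_n u_n=\{A : \{n : A\in u_n\}\in p\}$. $\mathscr G^p_1$ = principal ultrafilters on $\omega$, $\mathscr G^p_{\alpha+1}=\{p\text{-}\lim_n u_n : u_n\in\mathscr G^p_\alpha\text{ for all }n\}$, unions at limit ordinals, and $\mathscr G^p=\bigcup_{\alpha\ge1}\mathscr G^p_\alpha$. *)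

theory Defs
  imports "HOL-Library.Disjoint_Sets"
begin

section \<open>The semigroup of ultrafilters on the natural numbers\<close>

definition is_ultrafilter :: "nat set set \<Rightarrow> bool" where
  "is_ultrafilter U \<longleftrightarrow>
     UNIV \<in> U \<and> {} \<notin> U \<and>
     (\<forall>A B. A \<in> U \<and> B \<in> U \<longrightarrow> A \<inter> B \<in> U) \<and>
     (\<forall>A B. A \<in> U \<and> A \<subseteq> B \<longrightarrow> B \<in> U) \<and>
     (\<forall>A. A \<in> U \<or> - A \<in> U)"

typedef beta_omega = "{U. is_ultrafilter U}"
  morphisms members Abs_beta_omega
proof
  show "{A. (0::nat) \<in> A} \<in> {U. is_ultrafilter U}"
    by (auto simp: is_ultrafilter_def)
qed

setup_lifting type_definition_beta_omega

lift_definition principal_uf :: "nat \<Rightarrow> beta_omega" is "\<lambda>n. {A. n \<in> A}"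
  by (auto simp: is_ultrafilter_def)

lift_definition plim :: "beta_omega \<Rightarrow> (nat \<Rightarrow> beta_omega) \<Rightarrow> beta_omega"
  is "\<lambda>p u. {A. {n. A \<in> u n} \<in> p}"
proof -
  fix p and u :: "nat \<Rightarrow> nat set set"
  assume p: "is_ultrafilter p" and u: "\<And>n. is_ultrafilter (u n)"
  have mono: "T \<in> p" if "S \<in> p" "S \<subseteq> T" for S T
    using p that unfolding is_ultrafilter_def by blast
  have inter: "S \<inter> T \<in> p" if "S \<in> p" "T \<in> p" for S T
    using p that unfolding is_ultrafilter_def by blast
  have compl: "S \<in> p \<or> - S \<in> p" for S
    using p unfolding is_ultrafilter_def by blast
  have triv: "UNIV \<in> p" "{} \<notin> p"
    using p unfolding is_ultrafilter_def by blast+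
  show "is_ultrafilter {A. {n. A \<in> u n} \<in> p}"
    unfolding is_ultrafilter_def mem_Collect_eq
  proof (intro conjI allI impI)
    have "{n. UNIV \<in> u n} = UNIV" "{n. {} \<in> u n} = {}"
      using u unfolding is_ultrafilter_def by blast+
    then show "{n. UNIV \<in> u n} \<in> p" "{n. {} \<in> u n} \<notin> p"
      using triv by auto
  next
    fix A B assume "{n. A \<in> u n} \<in> p \<and> {n. B \<in> u n} \<in> p"
    then have "{n. A \<in> u n} \<inter> {n. B \<in> u n} \<in> p" by (simp add: inter)
    then show "{n. A \<inter> B \<in> u n} \<in> p"
      by (rule mono) (use u in \<open>unfold is_ultrafilter_def, blast\<close>)
  next
    fix A B :: "nat set" assume "{n. A \<in> u n} \<in> p \<and> A \<subseteq> B"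
    then have "{n. A \<in> u n} \<in> p" and AB: "A \<subseteq> B" by auto
    from this(1) show "{n. B \<in> u n} \<in> p"
      by (rule mono) (use u AB in \<open>unfold is_ultrafilter_def, blast\<close>)
  next
    fix A
    have "- {n. A \<in> u n} \<subseteq> {n. - A \<in> u n}"
      using u unfolding is_ultrafilter_def by blast
    then show "{n. A \<in> u n} \<in> p \<or> {n. - A \<in> u n} \<in> p"
      using compl mono by blast
  qed
qed

lift_definition shift_uf :: "nat \<Rightarrow> beta_omega \<Rightarrow> beta_omega"
  is "\<lambda>x v. {A. {y. x + y \<in> A} \<in> v}"
proof -
  fix x :: nat and v assume v: "is_ultrafilter v"
  have pre: "{y. x + y \<in> A} = (+) x -` A" for A by auto
  have mono: "(+) x -` A \<subseteq> (+) x -` B" if "A \<subseteq> B" for A B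
    using that by auto
  show "is_ultrafilter {A. {y. x + y \<in> A} \<in> v}"
    using v mono unfolding is_ultrafilter_def pre mem_Collect_eq vimage_Int vimage_Compl
      vimage_UNIV vimage_empty by metis
qed

instantiation beta_omega :: semigroup_add
begin

lift_definition plus_beta_omega :: "beta_omega \<Rightarrow> beta_omega \<Rightarrow> beta_omega"
  is "\<lambda>u v. {A. {x. {y. x + y \<in> A} \<in> v} \<in> u}"
proof -
  fix u v assume uv: "is_ultrafilter u" "is_ultrafilter v"
  have "members (plim (Abs_beta_omega u) (\<lambda>x. shift_uf x (Abs_beta_omega v)))
      = {A. {x. {y. x + y \<in> A} \<in> v} \<in> u}"
    using uv by (simp add: plim.rep_eq shift_uf.rep_eq Abs_beta_omega_inverse)
  then show "is_ultrafilter {A. {x. {y. x + y \<in> A} \<in> v} \<in> u}"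
    using members[of "plim (Abs_beta_omega u) (\<lambda>x. shift_uf x (Abs_beta_omega v))"] by simp
qed

instance
  by standard (transfer, simp add: add.assoc)

end

definition selective :: "beta_omega \<Rightarrow> bool" where
  "selective p \<longleftrightarrow>
     p \<notin> range principal_uf \<and>
     (\<forall>X :: nat \<Rightarrow> nat set. disjoint_family X \<and> (\<Union>n. X n) = UNIV \<longrightarrow>
        (\<exists>n. X n \<in> members p) \<or>
        (\<exists>A \<in> members p. \<forall>n. finite (A \<inter> X n) \<and> card (A \<inter> X n) \<le> 1))"


section \<open>The hierarchy\<close>

text \<open>Ordinals are represented by the elements of a well-order \<open>r\<close>: an element \<open>a\<close> of its
  field stands for the ordinal \<open>\<alpha> = 1 + t\<close>, where \<open>t\<close> is the order type of the elements strictly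
  below \<open>a\<close>. The least element stands for \<open>1\<close>, where the hierarchy starts, and \<open>a\<close> is a
  successor (limit) element iff \<open>\<alpha>\<close> is a successor \<open>> 1\<close> (limit) ordinal.\<close>

definition immediate_pred :: "'a rel \<Rightarrow> 'a \<Rightarrow> 'a \<Rightarrow> bool" where
  "immediate_pred r b a \<longleftrightarrow> b \<in> underS r a \<and> (\<forall>c \<in> underS r a. (c, b) \<in> r)"

definition G_step ::
  "'a rel \<Rightarrow> beta_omega \<Rightarrow> ('a \<Rightarrow> beta_omega set) \<Rightarrow> 'a \<Rightarrow> beta_omega set" where
  "G_step r p G a =
     (if underS r a = {} then range principal_uf
      else if \<exists>b. immediate_pred r b a
        then {plim p u | u. \<forall>n. u n \<in> G (THE b. immediate_pred r b a)}
      else (\<Union>b \<in> underS r a. G b))"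

definition G_level :: "'a rel \<Rightarrow> beta_omega \<Rightarrow> 'a \<Rightarrow> beta_omega set" where
  "G_level r p = wo_rel.worec r (G_step r p)"

text \<open>The union over all ordinals is taken over all ordinals below the successor cardinal of the
  cardinality of \<open>beta_omega\<close>; as an increasing chain of subsets of \<open>beta_omega\<close>, the hierarchy
  is stationary before that. So nothing is lost: by \<open>G_level_subset_hierarchy\<close> below, the levels
  along an arbitrary well-order on an arbitrary type are contained in this union.\<close>

definition ordinals :: "beta_omega set rel" where
  "ordinals = cardSuc (card_of (UNIV :: beta_omega set))"

definition hierarchy :: "beta_omega \<Rightarrow> beta_omega set" where
  "hierarchy p = (\<Union>\<alpha> \<in> Field ordinals. G_level ordinals p \<alpha>)"

lemma immediate_pred_the:
  assumes r: "Well_order r" and b: "immediate_pred r b a"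
  shows "(THE b. immediate_pred r b a) = b"
proof (rule the_equality[where P = "\<lambda>b. immediate_pred r b a", OF b])
  fix c assume "immediate_pred r c a"
  then have "(c, b) \<in> r" "(b, c) \<in> r"
    using b by (auto simp: immediate_pred_def)
  then show "c = b"
    using wo_rel.ANTISYM[of r] r by (auto simp: wo_rel_def antisym_def)
qed

lemma G_level_rec:
  assumes r: "Well_order r"
  shows "G_level r p a = G_step r p (G_level r p) a"
proof -
  have "wo_rel.adm_wo r (G_step r p)"
    unfolding wo_rel.adm_wo_def[OF wo_rel.intro[OF r]]
  proof (intro allI impI)
    fix f g a assume eq: "\<forall>y \<in> underS r a. f y = (g y :: beta_omega set)"
    show "G_step r p f a = G_step r p g a"
    proof (cases "\<exists>b. immediate_pred r b a")
      case True
      then obtain b where b: "immediate_pred r b a" by blast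
      then have "f b = g b" using eq by (auto simp: immediate_pred_def)
      then show ?thesis
        using b by (auto simp: G_step_def immediate_pred_the[OF r b])
    qed (use eq in \<open>simp add: G_step_def\<close>)
  qed
  from wo_rel.worec_fixpoint[OF wo_rel.intro[OF r] this] show ?thesis
    unfolding G_level_def by metis
qed

lemma G_level_one:
  assumes "Well_order r" "underS r a = {}"
  shows "G_level r p a = range principal_uf"
  using assms by (subst G_level_rec) (simp_all add: G_step_def)

lemma G_level_succ:
  assumes "Well_order r" "immediate_pred r b a"
  shows "G_level r p a = {plim p u | u. \<forall>n. u n \<in> G_level r p b}"
proof -
  have "underS r a \<noteq> {}" using assms by (auto simp: immediate_pred_def)
  then show ?thesis
    using assms by (subst G_level_rec) (auto simp add: G_step_def immediate_pred_the[OF assms])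
qed

lemma G_level_limit:
  assumes "Well_order r" "underS r a \<noteq> {}" "\<nexists>b. immediate_pred r b a"
  shows "G_level r p a = (\<Union>b \<in> underS r a. G_level r p b)"
  using assms by (subst G_level_rec) (simp_all add: G_step_def)

lemma plim_const: "plim p (\<lambda>_. u) = u"
proof -
  have "is_ultrafilter (members p)" using members by auto
  then have "members (plim p (\<lambda>_. u)) = members u"
    by (auto simp: plim.rep_eq is_ultrafilter_def split: if_splits)
  then show ?thesis by (simp add: members_inject)
qed

lemma G_level_mono:
  assumes r: "Well_order r" and "(a, b) \<in> r"
  shows "G_level r p a \<subseteq> G_level r p b"
proof -
  interpret wo_rel r by (rule wo_rel.intro[OF r])
  have "(a, b) \<in> r \<longrightarrow> G_level r p a \<subseteq> G_level r p b" for a b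
  proof (induction b arbitrary: a rule: well_order_induct)
    case (1 b)
    show ?case
    proof
      assume ab: "(a, b) \<in> r"
      show "G_level r p a \<subseteq> G_level r p b"
      proof (cases "a = b")
        case False
        then have a: "a \<in> underS b" using ab by (auto simp: underS_def)
        show ?thesis
        proof (cases "\<exists>c. immediate_pred r c b")
          case True
          then obtain c where c: "immediate_pred r c b" by blast
          then have "c \<noteq> b" "(c, b) \<in> r" "(a, c) \<in> r"
            using a by (auto simp: immediate_pred_def underS_def)
          then have "G_level r p a \<subseteq> G_level r p c" using 1 by blast
          also have "\<dots> \<subseteq> G_level r p b"
          proof
            fix u assume "u \<in> G_level r p c"
            then have "\<exists>f. u = plim p f \<and> (\<forall>n. f n \<in> G_level r p c)"
              by (intro exI[of _ "\<lambda>_. u"]) (simp add: plim_const)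
            then show "u \<in> G_level r p b"
              by (simp add: G_level_succ[OF r c])
          qed
          finally show ?thesis .
        next
          case False
          then have "G_level r p b = (\<Union>b \<in> underS b. G_level r p b)"
            using a by (intro G_level_limit[OF r]) auto
          then show ?thesis using a by auto
        qed
      qed simp
    qed
  qed
  then show ?thesis using assms by blast
qed

lemma infinite_beta_omega: "infinite (UNIV :: beta_omega set)"
proof -
  have "inj principal_uf"
  proof
    fix m n assume "principal_uf m = principal_uf n"
    then have "{A. m \<in> A} = {A. n \<in> A}" by (metis principal_uf.rep_eq)
    then have "{m} \<in> {A. n \<in> A}" by blast
    then show "m = n" by simp
  qed
  then show ?thesis
    using finite_subset[OF subset_UNIV] finite_imageD infinite_UNIV_nat by metis
qed

lemma ordinals_Card_order: "Card_order ordinals"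
  unfolding ordinals_def by (intro cardSuc_Card_order card_of_Card_order)

lemma ordinals_Well_order: "Well_order ordinals"
  using ordinals_Card_order by (simp add: card_order_on_def)

lemma infinite_ordinals: "infinite (Field ordinals)"
  unfolding ordinals_def cardSuc_finite[OF card_of_Card_order]
  by (simp add: infinite_beta_omega Field_card_of)

lemma ordinals_succ:
  assumes "a \<in> Field ordinals"
  shows "\<exists>b \<in> Field ordinals. immediate_pred ordinals a b"
proof -
  interpret wo_rel ordinals by (rule wo_rel.intro[OF ordinals_Well_order])
  obtain b where b: "b \<in> Field ordinals" "a \<noteq> b" "(a, b) \<in> ordinals"
    using infinite_Card_order_limit[OF ordinals_Card_order infinite_ordinals assms] by blast
  then have ne: "AboveS {a} \<noteq> {}" by (auto simp: AboveS_def)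
  have sub: "{a} \<subseteq> Field ordinals" using assms by simp
  let ?s = "suc {a}"
  have s: "?s \<in> Field ordinals" "?s \<noteq> a" "(a, ?s) \<in> ordinals"
    using suc_inField[OF sub ne] suc_greater[OF sub ne, of a] by auto
  have "(c, a) \<in> ordinals" if c: "c \<in> underS ?s" for c
  proof (rule ccontr)
    assume n: "(c, a) \<notin> ordinals"
    have cf: "c \<in> Field ordinals" "c \<noteq> ?s" "(c, ?s) \<in> ordinals"
      using c by (auto simp: underS_def Field_def)
    then have "(a, c) \<in> ordinals" "a \<noteq> c" using TOTALS assms n REFL
      by (auto simp: refl_on_def)
    then have "c \<in> AboveS {a}" using cf by (auto simp: AboveS_def)
    then have "(?s, c) \<in> ordinals" by (rule suc_least_AboveS)
    then show False using cf ANTISYM by (auto simp: antisym_def)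
  qed
  then have "immediate_pred ordinals a ?s"
    using s by (auto simp: immediate_pred_def underS_def)
  then show ?thesis using s by blast
qed

lemma principal_in_hierarchy: "principal_uf n \<in> hierarchy p"
proof -
  interpret wo_rel ordinals by (rule wo_rel.intro[OF ordinals_Well_order])
  have ne: "Field ordinals \<noteq> {}" using infinite_ordinals by auto
  let ?z = "minim (Field ordinals)"
  have z: "?z \<in> Field ordinals" using minim_in[OF subset_refl ne] .
  have "underS ?z = {}"
  proof (rule ccontr)
    assume "underS ?z \<noteq> {}"
    then obtain c where c: "c \<noteq> ?z" "(c, ?z) \<in> ordinals" by (auto simp: underS_def)
    then have "(?z, c) \<in> ordinals" using minim_least[OF subset_refl] by (auto simp: Field_def)
    then show False using c ANTISYM by (auto simp: antisym_def)
  qed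
  then show ?thesis
    using z G_level_one[OF ordinals_Well_order, of ?z p] unfolding hierarchy_def by blast
qed

lemma plim_in_hierarchy:
  assumes "\<And>n. u n \<in> hierarchy p"
  shows "plim p u \<in> hierarchy p"
proof -
  have chain: "relChain (cardSuc (card_of (UNIV :: beta_omega set))) (G_level ordinals p)"
    using G_level_mono[OF ordinals_Well_order]
    by (auto simp: relChain_def ordinals_def[symmetric])
  have "\<exists>a \<in> Field ordinals. range u \<subseteq> G_level ordinals p a"
  proof -
    have "range u \<subseteq> (\<Union>a \<in> Field ordinals. G_level ordinals p a)"
      using assms by (auto simp: hierarchy_def)
    moreover have "infinite (Field (card_of (UNIV :: beta_omega set)))"
      by (simp add: infinite_beta_omega Field_card_of)
    ultimately show ?thesis
      using cardSuc_UNION[OF card_of_Card_order _ chain, of "range u"] card_of_mono1[of "range u" UNIV]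
      unfolding ordinals_def[symmetric] by blast
  qed
  then obtain a where a: "a \<in> Field ordinals" "range u \<subseteq> G_level ordinals p a" by blast
  then obtain b where b: "b \<in> Field ordinals" "immediate_pred ordinals a b"
    using ordinals_succ by blast
  have "plim p u \<in> G_level ordinals p b"
    using a G_level_succ[OF ordinals_Well_order b(2)] by auto
  then show ?thesis using b by (auto simp: hierarchy_def)
qed

lemma G_level_subset_hierarchy:
  fixes r :: "'a rel"
  assumes r: "Well_order r"
  shows "G_level r p a \<subseteq> hierarchy p"
proof -
  interpret wo_rel r by (rule wo_rel.intro[OF r])
  show ?thesis
  proof (induction a rule: well_order_induct)
    case (1 a)
    then have IH: "G_level r p b \<subseteq> hierarchy p" if "b \<in> underS a" for b
      using that by (auto simp: underS_def)
    consider "underS a = {}" | b where "immediate_pred r b a"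
      | "underS a \<noteq> {}" "\<nexists>b. immediate_pred r b a" by blast
    then show ?case
    proof cases
      case 1
      then show ?thesis
        using G_level_one[OF r] principal_in_hierarchy by auto
    next
      case 2
      then have "b \<in> underS a" by (simp add: immediate_pred_def)
      then show ?thesis
        using IH[of b] unfolding G_level_succ[OF r 2] by (auto intro!: plim_in_hierarchy)
    next
      case 3
      then show ?thesis using IH G_level_limit[OF r] by auto
    qed
  qed
qed

end

theory Submission
  imports Defs "HOL-Library.Countable_Set"
begin

text \<open>Selectivity of \<open>p\<close> makes a limit \<open>u = plim p a\<close> rigid: unless \<open>a\<close> is constant on a set in \<open>p\<close>,
  pairwise disjoint sets can be chosen in the \<open>a n\<close>, for \<open>n\<close> in a set in \<open>p\<close>. Any countable set
  of ultrafilters other than \<open>u\<close> that avoid all these fibres is then separated from \<open>u\<close> by a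
  single set, and two nonconstant limits that agree have equal terms on a set in \<open>p\<close>.

  By induction on the level, an element of the hierarchy is not a limit of countably many others
  of the same or a higher level. Hence the translates of \<open>w\<close>, which all have the same level, form
  a discrete set, and \<open>u\<close> can be read off \<open>u + w\<close>. For left cancellation, induct on \<open>u\<close>: if
  \<open>u = plim p f\<close> is a nonconstant limit, then so are \<open>u + v\<close> and \<open>u + w\<close> by right cancellation,
  so \<open>f n + v = f n + w\<close> for some \<open>n\<close>.\<close>

section \<open>Ultrafilters and limits along them\<close>

lemma is_ultrafilter_members: "is_ultrafilter (members u)"
  using members by auto

lemma UNIV_members [simp]: "UNIV \<in> members u"
  and empty_members [simp]: "{} \<notin> members u"
  using is_ultrafilter_members[of u] by (auto simp: is_ultrafilter_def)

lemma members_mono: "A \<in> members u \<Longrightarrow> A \<subseteq> B \<Longrightarrow> B \<in> members u"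
  using is_ultrafilter_members[of u] unfolding is_ultrafilter_def by blast

lemma Int_members_iff [simp]: "A \<inter> B \<in> members u \<longleftrightarrow> A \<in> members u \<and> B \<in> members u"
proof
  show "A \<inter> B \<in> members u \<Longrightarrow> A \<in> members u \<and> B \<in> members u"
    using members_mono by blast
  show "A \<in> members u \<and> B \<in> members u \<Longrightarrow> A \<inter> B \<in> members u"
    using is_ultrafilter_members[of u] unfolding is_ultrafilter_def by blast
qed

lemma Compl_members_iff [simp]: "- A \<in> members u \<longleftrightarrow> A \<notin> members u"
proof -
  have "A \<in> members u \<or> - A \<in> members u"
    using is_ultrafilter_members[of u] unfolding is_ultrafilter_def by blast
  moreover have "\<not> (A \<in> members u \<and> - A \<in> members u)"
    using Int_members_iff[of A "- A" u] by simp
  ultimately show ?thesis by blast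
qed

lemma Un_members_iff [simp]: "A \<union> B \<in> members u \<longleftrightarrow> A \<in> members u \<or> B \<in> members u"
  using Compl_members_iff[of "A \<union> B" u] Int_members_iff[of "- A" "- B" u]
  unfolding Compl_members_iff Compl_Un[symmetric] by blast

lemma Collect_not_members_iff [simp]: "{n. \<not> P n} \<in> members u \<longleftrightarrow> {n. P n} \<notin> members u"
  using Compl_members_iff[of "{n. P n}" u] by (simp add: Collect_neg_eq)

lemma Diff_members_iff [simp]: "A - B \<in> members u \<longleftrightarrow> A \<in> members u \<and> B \<notin> members u"
  by (simp add: Diff_eq)

lemma UN_members_iff:
  "finite I \<Longrightarrow> (\<Union>i\<in>I. A i) \<in> members u \<longleftrightarrow> (\<exists>i\<in>I. A i \<in> members u)"
  by (induction I rule: finite_induct) auto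

lemma INT_members_iff:
  "finite I \<Longrightarrow> (\<Inter>i\<in>I. A i) \<in> members u \<longleftrightarrow> (\<forall>i\<in>I. A i \<in> members u)"
  by (induction I rule: finite_induct) auto

lemma members_nonempty: "A \<in> members u \<Longrightarrow> A \<noteq> {}"
  by auto

lemma separating_set: "u \<noteq> v \<Longrightarrow> \<exists>B \<in> members u. B \<notin> members v"
  by (metis Compl_members_iff members_inject subsetI subset_antisym)

lemma members_principal [simp]: "A \<in> members (principal_uf n) \<longleftrightarrow> n \<in> A"
  by (simp add: principal_uf.rep_eq)

lemma members_plim: "A \<in> members (plim p u) \<longleftrightarrow> {n. A \<in> members (u n)} \<in> members p"
  by (simp add: plim.rep_eq)

lemma beta_omega_eqI: "(\<And>A. A \<in> members u \<longleftrightarrow> A \<in> members v) \<Longrightarrow> u = v"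
  by (metis members_inject subsetI subset_antisym)

lemma principal_if_singleton: "{x} \<in> members u \<Longrightarrow> u = principal_uf x"
  using separating_set[of "principal_uf x" u] members_mono[of "{x}" u] by fastforce

lemma finite_not_members:
  assumes "u \<notin> range principal_uf" "finite F"
  shows "F \<notin> members u"
proof
  assume "F \<in> members u"
  then have "(\<Union>x\<in>F. {x}) \<in> members u" by simp
  then obtain x where "{x} \<in> members u" using assms(2) by (subst (asm) UN_members_iff) auto
  then show False using principal_if_singleton assms(1) by blast
qed

lemma plim_principal [simp]: "plim (principal_uf x) f = f x"
  by (rule beta_omega_eqI) (simp add: members_plim)

lemma plim_assoc: "plim (plim p u) f = plim p (\<lambda>n. plim (u n) f)"
  by (rule beta_omega_eqI) (simp add: members_plim)

text \<open>The continuous extension of \<open>f\<close> to \<beta>\<omega>. Writing it as a limit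
  makes it commute with \<open>plim\<close> by associativity of limits.\<close>

definition image_uf :: "(nat \<Rightarrow> nat) \<Rightarrow> beta_omega \<Rightarrow> beta_omega" where
  "image_uf f u = plim u (\<lambda>x. principal_uf (f x))"

lemma members_image_uf: "A \<in> members (image_uf f u) \<longleftrightarrow> {x. f x \<in> A} \<in> members u"
  by (simp add: image_uf_def members_plim)

lemma image_uf_principal [simp]: "image_uf f (principal_uf x) = principal_uf (f x)"
  by (simp add: image_uf_def)

lemma image_uf_plim: "image_uf f (plim p u) = plim p (\<lambda>n. image_uf f (u n))"
  by (simp add: image_uf_def plim_assoc)

lemma members_plus: "A \<in> members (u + v) \<longleftrightarrow> {x. {y. x + y \<in> A} \<in> members v} \<in> members u"
  by (simp add: plus_beta_omega.rep_eq)

lemma plus_plim: "plim p u + v = plim p (\<lambda>n. u n + v)"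
  by (rule beta_omega_eqI) (simp add: members_plim members_plus)

lemma principal_plus: "principal_uf x + v = image_uf ((+) x) v"
  by (rule beta_omega_eqI) (simp add: members_plus members_image_uf)

text \<open>Truncated subtraction inverts addition of \<open>x\<close>, so an image map undoes the
  translation.\<close>

lemma image_diff_principal_plus: "image_uf (\<lambda>n. n - x) (principal_uf x + v) = v"
  by (rule beta_omega_eqI) (simp add: members_plus members_image_uf)

text \<open>Colour \<open>n\<close> by the parity of \<open>n div k\<close>: adding \<open>k\<close> changes the colour.\<close>

lemma principal_plus_neq:
  assumes "k > 0"
  shows "principal_uf k + u \<noteq> u"
proof
  assume eq: "principal_uf k + u = u"
  have "{n. even (n div k)} \<in> members (principal_uf k + u) \<longleftrightarrow> {n. even (n div k)} \<in> members u"
    by (simp only: eq)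
  then have "{n. even ((k + n) div k)} \<in> members u \<longleftrightarrow> {n. even (n div k)} \<in> members u"
    by (simp add: members_plus)
  moreover have "{n. even ((k + n) div k)} = {n. \<not> even (n div k)}"
    using assms by auto
  ultimately show False by simp
qed

text \<open>Cancelling the smaller summand would leave \<open>w\<close> fixed by a positive
  translation.\<close>

lemma principal_plus_inject:
  assumes "principal_uf x + w = principal_uf y + w"
  shows "x = y"
proof -
  have *: "principal_uf x + w \<noteq> principal_uf y + w" if "x < y" for x y
  proof
    assume eq: "principal_uf x + w = principal_uf y + w"
    have "principal_uf y = principal_uf x + principal_uf (y - x)"
      using that by (simp add: principal_plus)
    then have "principal_uf x + w = principal_uf x + (principal_uf (y - x) + w)"
      using eq by (simp add: add.assoc)
    then have "w = principal_uf (y - x) + w"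
      by (metis image_diff_principal_plus)
    then show False using that principal_plus_neq[of "y - x" w] by simp
  qed
  then show ?thesis using assms by (metis linorder_neqE_nat)
qed

section \<open>Selective ultrafilters\<close>

lemma selective_nonprincipal: "selective p \<Longrightarrow> p \<notin> range principal_uf"
  by (simp add: selective_def)

text \<open>The fibres of \<open>f\<close> partition \<omega>: \<open>f\<close> is constant on a
  fibre in \<open>p\<close> and injective on a selector.\<close>

lemma selective_const_or_inj:
  fixes f :: "nat \<Rightarrow> nat"
  assumes "selective p"
  shows "(\<exists>c. {n. f n = c} \<in> members p) \<or> (\<exists>A\<in>members p. inj_on f A)"
proof -
  let ?X = "\<lambda>c. {n. f n = c}"
  have "disjoint_family ?X \<and> (\<Union>c. ?X c) = UNIV"
    by (auto simp: disjoint_family_on_def)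
  then consider c where "?X c \<in> members p"
    | A where "A \<in> members p" "\<And>c. finite (A \<inter> ?X c) \<and> card (A \<inter> ?X c) \<le> 1"
    using conjunct2[OF assms[unfolded selective_def], THEN spec, of ?X] by auto
  then show ?thesis
  proof cases
    case 2
    have "inj_on f A"
    proof (rule inj_onI)
      fix x y assume xy: "x \<in> A" "y \<in> A" "f x = f y"
      have fin: "finite (A \<inter> ?X (f x))" and "card (A \<inter> ?X (f x)) \<le> Suc 0"
        using 2(2)[of "f x"] by simp_all
      from this(2) have "\<forall>a\<in>A \<inter> ?X (f x). \<forall>b\<in>A \<inter> ?X (f x). a = b"
        by (rule iffD1[OF card_le_Suc0_iff_eq[OF fin]])
      moreover have "x \<in> A \<inter> ?X (f x)" "y \<in> A \<inter> ?X (f x)" using xy by simp_all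
      ultimately show "x = y" by (meson bspec)
    qed
    then show ?thesis using 2(1) by blast
  qed blast
qed

text \<open>Below, \<open>m \<in> X i\<close> for all \<open>i < f m\<close>, and \<open>f\<close> is injective on a set in \<open>p\<close>. Selecting from
  every second interval of a sufficiently sparse interval partition forces \<open>f m > n\<close> for
  \<open>n < m\<close>.\<close>

lemma selective_diagonal:
  assumes p: "selective p" and X: "\<And>n. X n \<in> members p"
  obtains A where "A \<in> members p" "\<forall>n\<in>A. \<forall>m\<in>A. n < m \<longrightarrow> m \<in> X n"
proof -
  note fin = finite_not_members[OF selective_nonprincipal[OF p]]
  \<comment> \<open>The alternative \<open>m \<le> n\<close> ensures that the minimum exists. It
    cannot make \<open>f\<close> constant on a set in \<open>p\<close>, since \<open>p\<close> has
    no finite members.\<close>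
  define f where "f m = (LEAST n. m \<notin> X n \<or> m \<le> n)" for m
  have f: "m \<in> X i" if "i < f m" for i m
    using not_less_Least[of i "\<lambda>n. m \<notin> X n \<or> m \<le> n"] that by (auto simp: f_def)
  have f': "m \<notin> X (f m) \<or> m \<le> f m" for m
    unfolding f_def by (rule LeastI[of "\<lambda>n. m \<notin> X n \<or> m \<le> n" m]) simp
  have "{n. f n = c} \<notin> members p" for c
  proof
    assume "{n. f n = c} \<in> members p"
    moreover have "{n. f n = c} \<subseteq> - X c \<union> {..c}" using f' by auto
    ultimately have "- X c \<union> {..c} \<in> members p" by (rule members_mono)
    then show False using X fin[of "{..c}"] by simp
  qed
  then obtain A where A: "A \<in> members p" "inj_on f A"
    using selective_const_or_inj[OF p, of f] by blast
  have "\<exists>b. \<forall>m\<in>A. f m \<le> n \<longrightarrow> m < b" for n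
  proof -
    have "finite (A \<inter> f -` {..n})"
      by (rule finite_imageD[where f = f])
        (use A in \<open>auto intro: finite_subset[of _ "{..n}"] inj_on_subset\<close>)
    then show ?thesis by (auto simp: finite_nat_set_iff_bounded)
  qed
  then obtain b where b: "\<And>n m. m \<in> A \<Longrightarrow> f m \<le> n \<Longrightarrow> m < b n" by metis
  \<comment> \<open>The step past \<open>b (k i)\<close> ensures that \<open>m \<in> A\<close> and
    \<open>m \<ge> k (Suc i)\<close> give \<open>f m > k i\<close>.\<close>
  define k where "k = rec_nat 0 (\<lambda>_ x. Suc (x + b x))"
  have k: "k (Suc i) = Suc (k i + b (k i))" for i by (simp add: k_def)
  have "strict_mono k" by (rule strict_mono_Suc_iff[THEN iffD2]) (simp add: k)
  then have k_mono: "k i \<le> k j" if "i \<le> j" for i j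
    using that by (simp add: strict_mono_less_eq)
  have k_ge: "i \<le> k i" for i using \<open>strict_mono k\<close> by (rule strict_mono_imp_increasing)
  define g where "g m = (LEAST j. m < k (Suc j))" for m
  have g: "m < k (Suc (g m))" for m
    unfolding g_def by (rule LeastI[of _ m]) (use k_ge[of "Suc m"] in simp)
  have g_le: "g m \<le> j" if "m < k (Suc j)" for m j
    unfolding g_def using that by (rule Least_le)
  have g': "k (Suc j) \<le> m" if "j < g m" for j m
    using g_le[of m j] that by linarith
  have "{n. g n = c} \<notin> members p" for c
  proof -
    have "{n. g n = c} \<subseteq> {..<k (Suc c)}" using g by auto
    then show ?thesis using fin[of "{n. g n = c}"] finite_subset by blast
  qed
  then obtain B where B: "B \<in> members p" "inj_on g B"
    using selective_const_or_inj[OF p, of g] by blast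
  \<comment> \<open>One parity class of interval indices is large; within it, points of different
    intervals have a whole interval between them.\<close>
  obtain c where c: "{n. even (g n) = c} \<in> members p"
  proof (cases "{n. even (g n)} \<in> members p")
    case True
    then have "{n. even (g n) = True} \<in> members p" by simp
    then show ?thesis by (rule that)
  next
    case False
    then have "{n. even (g n) = False} \<in> members p" by simp
    then show ?thesis by (rule that)
  qed
  define E where "E = {n. even (g n) = c}"
  have "m \<in> X n" if nm: "n \<in> A \<inter> B \<inter> E" "m \<in> A \<inter> B \<inter> E" "n < m" for n m
  proof -
    have "g n \<le> g m" using g[of m] nm(3) by (intro g_le) linarith
    moreover have "g n \<noteq> g m" using B nm by (auto dest: inj_onD)
    moreover have "even (g m) \<longleftrightarrow> even (g n)" using nm by (simp add: E_def)
    ultimately have "Suc (g n) < g m" by (metis Suc_lessI even_Suc le_neq_implies_less)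
    then have "k (Suc (Suc (g n))) \<le> m" by (rule g')
    then have "\<not> m < b (k (Suc (g n)))" by (simp add: k)
    then have "k (Suc (g n)) < f m" using b[of m] nm by (meson IntD1 not_le_imp_less)
    then show ?thesis using g[of n] f[of n m] by linarith
  qed
  moreover have "A \<inter> B \<inter> E \<in> members p" using A B c by (simp add: E_def)
  ultimately show ?thesis using that by blast
qed

text \<open>If \<open>g\<close> is constant on a set in \<open>p\<close>, drop its value. Otherwise
  diagonalise against both \<open>g n = m\<close> and \<open>n = g m\<close> for
  \<open>m < n\<close>, which rules out values of \<open>g\<close> in the set below and above the
  argument.\<close>

lemma selective_image_disjoint:
  assumes p: "selective p" and g: "{n. g n \<noteq> n} \<in> members p"
  shows "\<exists>T\<in>members p. \<forall>n\<in>T. g n \<notin> T"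
proof (cases "\<exists>m. {n. g n = m} \<in> members p")
  case True
  then obtain m where m: "{n. g n = m} \<in> members p" by blast
  have "{m} \<notin> members p"
    by (rule finite_not_members[OF selective_nonprincipal[OF p]]) simp
  then show ?thesis using m by (intro bexI[of _ "{n. g n = m} - {m}"]) auto
next
  case False
  have "- {g m} \<in> members p" for m
    using finite_not_members[OF selective_nonprincipal[OF p], of "{g m}"] by simp
  then have "{n. g n \<noteq> m} \<inter> - {g m} \<in> members p" for m
    using False by simp
  then obtain A where A: "A \<in> members p"
      "\<forall>m\<in>A. \<forall>n\<in>A. m < n \<longrightarrow> n \<in> {n. g n \<noteq> m} \<inter> - {g m}"
    by (rule selective_diagonal[OF p, of "\<lambda>m. {n. g n \<noteq> m} \<inter> - {g m}"])
  have "g n \<notin> A" if "n \<in> A" "g n \<noteq> n" for n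
    using A(2) that by (cases "g n < n") force+
  then show ?thesis using A g by (intro bexI[of _ "A \<inter> {n. g n \<noteq> n}"]) auto
qed

section \<open>Nonconstant limits along a selective ultrafilter\<close>

text \<open>A set \<open>B n\<close> that separates \<open>a n\<close> from the limit lies in
  \<open>a m\<close> for almost no \<open>m\<close>. After diagonalising, \<open>a m\<close>
  contains no earlier \<open>B n\<close>, so these can be subtracted from
  \<open>B m\<close>.\<close>

lemma plim_disjoint_family:
  assumes p: "selective p" and a: "{n. a n = plim p a} \<notin> members p"
  shows "\<exists>D. disjoint_family D \<and> {n. D n \<in> members (a n)} \<in> members p"
proof -
  define Z where "Z = {n. a n \<noteq> plim p a}"
  have Z: "Z \<in> members p" using a by (simp add: Z_def)
  have "\<exists>B. n \<in> Z \<longrightarrow> B \<in> members (a n) \<and> B \<notin> members (plim p a)" for n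
    unfolding Z_def using separating_set by blast
  then obtain B where B: "\<And>n. n \<in> Z \<Longrightarrow> B n \<in> members (a n)"
      "\<And>n. n \<in> Z \<Longrightarrow> B n \<notin> members (plim p a)" by metis
  have "{m. n \<in> Z \<longrightarrow> B n \<notin> members (a m)} \<in> members p" for n
    using B(2)[of n] by (cases "n \<in> Z") (simp_all add: members_plim)
  then obtain A where A: "A \<in> members p"
      "\<forall>n\<in>A. \<forall>m\<in>A. n < m \<longrightarrow> m \<in> {m. n \<in> Z \<longrightarrow> B n \<notin> members (a m)}"
    by (rule selective_diagonal[OF p, of "\<lambda>n. {m. n \<in> Z \<longrightarrow> B n \<notin> members (a m)}"])
  define D where "D m = (if m \<in> A \<inter> Z then B m - (\<Union>n\<in>{..<m} \<inter> A \<inter> Z. B n) else {})" for m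
  have "D m \<inter> D n = {}" if "m < n" for m n using that by (auto simp: D_def)
  then have "disjoint_family D"
    unfolding disjoint_family_on_def by (metis inf_commute linorder_neqE_nat)
  moreover have "{n. D n \<in> members (a n)} \<in> members p"
  proof (rule members_mono)
    show "A \<inter> Z \<in> members p" using A(1) Z by simp
    have "D m \<in> members (a m)" if "m \<in> A \<inter> Z" for m
      using that A(2) B(1)[of m] by (auto simp: D_def UN_members_iff)
    then show "A \<inter> Z \<subseteq> {n. D n \<in> members (a n)}" by blast
  qed
  ultimately show ?thesis by blast
qed

lemma UN_members_plim:
  assumes "{n. C n \<in> members (a n)} \<in> members p"
  shows "(\<Union>n. C n) \<in> members (plim p a)"
  using assms unfolding members_plim by (rule members_mono) (auto intro: members_mono)

text \<open>Inside the fibre \<open>D n\<close> the union coincides with \<open>C n\<close>.\<close>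

lemma UN_disjoint_members_iff:
  assumes "disjoint_family D" "D n \<in> members v" "\<And>m. C m \<subseteq> D m"
  shows "(\<Union>m. C m) \<in> members v \<longleftrightarrow> C n \<in> members v"
proof -
  have "C m \<inter> D n \<subseteq> C n" for m
    using assms(1) assms(3)[of m] unfolding disjoint_family_on_def by (cases "m = n") blast+
  then have "(\<Union>m. C m) \<inter> D n = C n" using assms(3)[of n] by blast
  then show ?thesis using assms(2) Int_members_iff[of "\<Union>m. C m" "D n" v] by simp
qed

text \<open>Ultrafilters that avoid the fibres \<open>D n\<close> are handled by the p-point property of \<open>p\<close>:
  the set \<open>B\<close> below is almost contained, modulo finitely many fibres, in each of countably many
  given sets.\<close>

lemma plim_separated_off_fibres:
  assumes p: "selective p" and V: "countable V" "plim p a \<notin> V"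
    and D: "{n. D n \<in> members (a n)} \<in> members p"
    and DV: "\<And>v n. v \<in> V \<Longrightarrow> D n \<notin> members v"
  shows "\<exists>B\<in>members (plim p a). \<forall>v\<in>V. B \<notin> members v"
proof (cases "V = {}")
  case True
  then show ?thesis using UNIV_members by blast
next
  case False
  define v where "v = from_nat_into V"
  have v: "v k \<in> V" for k using False by (simp add: v_def from_nat_into)
  have "plim p a \<noteq> v k" for k using v[of k] V(2) by metis
  then have "\<exists>B\<in>members (plim p a). B \<notin> members (v k)" for k
    by (rule separating_set)
  then obtain B where B: "\<And>k. B k \<in> members (plim p a)" "\<And>k. B k \<notin> members (v k)" by metis
  define B' where "B' k = (\<Inter>i\<le>k. B i)" for k
  have "B' k \<in> members (plim p a)" for k using B by (simp add: B'_def INT_members_iff)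
  then have "{m. B' k \<in> members (a m)} \<in> members p" for k by (simp add: members_plim)
  then obtain A where A: "A \<in> members p"
      "\<forall>k\<in>A. \<forall>m\<in>A. k < m \<longrightarrow> m \<in> {m. B' k \<in> members (a m)}"
    by (rule selective_diagonal[OF p, of "\<lambda>k. {m. B' k \<in> members (a m)}"])
  \<comment> \<open>Each fibre is cut down by the sets with earlier index in \<open>A\<close>; these
    are finitely many and, for \<open>m \<in> A\<close>, all belong to \<open>a m\<close>.\<close>
  define C where "C m = D m \<inter> (\<Inter>i\<in>{..<m} \<inter> A. B' i)" for m
  have "(\<Union>m. C m) \<in> members (plim p a)"
  proof (rule UN_members_plim, rule members_mono)
    show "A \<inter> {n. D n \<in> members (a n)} \<in> members p" using A D by simp
    show "A \<inter> {n. D n \<in> members (a n)} \<subseteq> {n. C n \<in> members (a n)}"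
      using A(2) by (auto simp: C_def INT_members_iff)
  qed
  moreover have "(\<Union>m. C m) \<notin> members (v k)" for k
  proof
    assume C: "(\<Union>m. C m) \<in> members (v k)"
    have "infinite A" using A finite_not_members[OF selective_nonprincipal[OF p]] by blast
    \<comment> \<open>As \<open>k \<le> i\<close>, the set \<open>B' i\<close> lies in
      \<open>B k\<close>, so only the finitely many fibres up to \<open>i\<close> can leave
      \<open>B k\<close>, and \<open>v k\<close> contains none of them.\<close>
    then obtain i where i: "i \<in> A" "k \<le> i" using infinite_nat_iff_unbounded_le by blast
    have "C m \<subseteq> B k" if "i < m" for m
      using that i by (auto simp: C_def B'_def)
    then have "(\<Union>m. C m) \<subseteq> (\<Union>m\<le>i. D m) \<union> B k"
      by (force simp: C_def not_le[symmetric])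
    with C have "(\<Union>m\<le>i. D m) \<union> B k \<in> members (v k)" by (rule members_mono)
    then show False using B(2) DV[OF v] by (simp add: UN_members_iff)
  qed
  moreover have "\<exists>k. x = v k" if "x \<in> V" for x
    using that V(1) unfolding v_def by (metis from_nat_into_surj)
  ultimately show ?thesis by blast
qed

text \<open>Choose disjoint fibres for \<open>a\<close>. Almost every \<open>b n\<close> contains
  some fibre \<open>D (g n)\<close>, as otherwise the \<open>b n\<close> would be separated from
  their own limit. If the terms differ, the fibres can be shrunk so that their union lies in one
  limit but not in the other.\<close>

lemma plim_eq_imp_eventually_eq:
  assumes p: "selective p" and eq: "plim p a = plim p b"
    and a: "{n. a n = plim p a} \<notin> members p" and b: "{n. b n = plim p b} \<notin> members p"
  shows "{n. a n = b n} \<in> members p"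
proof (rule ccontr)
  assume neq: "{n. a n = b n} \<notin> members p"
  from plim_disjoint_family[OF p a] obtain D
    where D: "disjoint_family D" "{n. D n \<in> members (a n)} \<in> members p" by blast
  define S where "S = {n. b n \<noteq> plim p b \<and> (\<forall>m. D m \<notin> members (b n))}"
  have "S \<notin> members p"
  proof
    assume S: "S \<in> members p"
    have "\<exists>B\<in>members (plim p a). \<forall>v\<in>b ` S. B \<notin> members v"
      by (rule plim_separated_off_fibres[OF p _ _ D(2)]) (auto simp: S_def eq)
    then obtain B where B: "B \<in> members (plim p b)" "\<And>n. n \<in> S \<Longrightarrow> B \<notin> members (b n)"
      using eq by auto
    then have "S \<inter> {n. B \<in> members (b n)} \<in> members p" using S by (simp add: members_plim)
    then show False using B(2) members_nonempty by blast
  qed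
  then have "{n. b n \<noteq> plim p b} \<inter> - S \<in> members p" using b by simp
  then have ex: "{n. \<exists>m. D m \<in> members (b n)} \<in> members p"
    by (rule members_mono) (auto simp: S_def)
  define g where "g n = (SOME m. D m \<in> members (b n))" for n
  have Dg: "{n. D (g n) \<in> members (b n)} \<in> members p"
    using ex by (rule members_mono) (auto simp: g_def intro: someI)
  \<comment> \<open>The union of the \<open>C n\<close> lies in the common limit, but
    \<open>b n\<close> sees only the part inside \<open>D (g n)\<close>.\<close>
  have contra: False if C: "\<And>n. C n \<subseteq> D n" "{n. C n \<in> members (a n)} \<in> members p"
      "{n. C (g n) \<notin> members (b n)} \<in> members p" for C
  proof -
    have "{n. (\<Union>m. C m) \<in> members (b n)} \<in> members p"
      using UN_members_plim[OF C(2)] by (simp add: eq members_plim)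
    then have "{n. (\<Union>m. C m) \<in> members (b n)} \<inter> {n. D (g n) \<in> members (b n)} \<inter>
        {n. C (g n) \<notin> members (b n)} \<in> members p"
      using C(3) Dg by simp
    then obtain n where n: "(\<Union>m. C m) \<in> members (b n)" "D (g n) \<in> members (b n)"
        "C (g n) \<notin> members (b n)"
      using members_nonempty by blast
    then show False using UN_disjoint_members_iff[OF D(1), of "g n" "b n" C] C(1) by blast
  qed
  show False
  proof (cases "{n. g n = n} \<in> members p")
    case True
    have "\<exists>B. a n \<noteq> b n \<longrightarrow> B \<in> members (a n) \<and> B \<notin> members (b n)" for n
      using separating_set by blast
    then obtain B where B: "\<And>n. a n \<noteq> b n \<Longrightarrow> B n \<in> members (a n) \<and> B n \<notin> members (b n)"
      by metis
    have N: "{n. a n \<noteq> b n} \<in> members p" using neq by simp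
    show False
    \<comment> \<open>Both terms contain the same fibre, so it is cut by a set separating
      \<open>a n\<close> from \<open>b n\<close>.\<close>
    proof (rule contra[of "\<lambda>n. B n \<inter> D n"])
      have "{n. a n \<noteq> b n} \<inter> {n. D n \<in> members (a n)} \<in> members p" using N D by simp
      then show "{n. B n \<inter> D n \<in> members (a n)} \<in> members p"
        by (rule members_mono) (use B in auto)
      have "{n. a n \<noteq> b n} \<inter> {n. g n = n} \<in> members p" using N True by simp
      then show "{n. B (g n) \<inter> D (g n) \<notin> members (b n)} \<in> members p"
        by (rule members_mono) (use B in auto)
    qed auto
  next
    case False
    then have "{n. g n \<noteq> n} \<in> members p" by simp
    from selective_image_disjoint[OF p this]
    obtain T where T: "T \<in> members p" "\<And>n. n \<in> T \<Longrightarrow> g n \<notin> T" by blast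
    show False
    \<comment> \<open>Only fibres with index in \<open>T\<close> are kept, and \<open>g\<close> maps
      \<open>T\<close> outside \<open>T\<close>.\<close>
    proof (rule contra[of "\<lambda>n. if n \<in> T then D n else {}"])
      have "T \<inter> {n. D n \<in> members (a n)} \<in> members p" using T D by simp
      then show "{n. (if n \<in> T then D n else {}) \<in> members (a n)} \<in> members p"
        by (rule members_mono) auto
      show "{n. (if g n \<in> T then D (g n) else {}) \<notin> members (b n)} \<in> members p"
        by (rule members_mono[OF T(1)]) (use T(2) in auto)
    qed auto
  qed
qed

section \<open>The levels of the hierarchy\<close>

lemma G_level_cases [consumes 2, case_names principal plim lower]:
  assumes "Well_order r" "u \<in> G_level r p a"
  obtains x where "u = principal_uf x"
    | f b where "u = plim p f" "b \<in> underS r a" "\<And>n. f n \<in> G_level r p b"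
    | b where "b \<in> underS r a" "u \<in> G_level r p b"
proof -
  consider "underS r a = {}" | b where "immediate_pred r b a"
    | "underS r a \<noteq> {}" "\<nexists>b. immediate_pred r b a" by blast
  then show ?thesis
  proof cases
    case 1
    then show ?thesis using G_level_one[of r a p] assms that(1) by blast
  next
    case 2
    with assms(2) obtain f where f: "u = plim p f" "\<And>n. f n \<in> G_level r p b"
      unfolding G_level_succ[OF assms(1) 2] by auto
    have "b \<in> underS r a" using 2 by (simp add: immediate_pred_def)
    then show ?thesis using f that(2) by blast
  next
    case 3
    then show ?thesis using G_level_limit[OF assms(1) 3, of p] assms(2) that(3) by blast
  qed
qed

lemma underS_induct:
  assumes r: "Well_order r" and "\<And>a. (\<And>b. b \<in> underS r a \<Longrightarrow> P b) \<Longrightarrow> P a"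
  shows "P a"
proof -
  interpret wo_rel r by (rule wo_rel.intro[OF r])
  show ?thesis
    by (induction a rule: well_order_induct) (use assms(2) in \<open>auto simp: underS_def\<close>)
qed

lemma hierarchy_induct [consumes 1, case_names principal plim]:
  assumes "u \<in> hierarchy p"
    and "\<And>x. P (principal_uf x)"
    and "\<And>f. (\<And>n. f n \<in> hierarchy p) \<Longrightarrow> (\<And>n. P (f n)) \<Longrightarrow> P (plim p f)"
  shows "P u"
proof -
  have "\<forall>u\<in>G_level ordinals p a. P u" for a
  proof (induction a rule: underS_induct[OF ordinals_Well_order])
    case (1 a)
    show ?case
    proof
      fix u assume "u \<in> G_level ordinals p a"
      with ordinals_Well_order show "P u"
      proof (cases rule: G_level_cases)
        case (plim f b)
        then show ?thesis
          using 1 G_level_subset_hierarchy[OF ordinals_Well_order] assms(3)[of f] by blast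
      qed (use 1 assms(2) in auto)
    qed
  qed
  then show ?thesis using assms(1) by (auto simp: hierarchy_def)
qed

text \<open>Images preserve principality and commute with \<open>plim\<close>, so they never raise
  the level. Applied to a translation and to its inverse, this shows that translates share their
  levels.\<close>

lemma image_uf_G_level:
  assumes r: "Well_order r" and "u \<in> G_level r p a"
  shows "image_uf f u \<in> G_level r p a"
proof -
  have "\<forall>u\<in>G_level r p a. image_uf f u \<in> G_level r p a" for a
  proof (induction a rule: underS_induct[OF r])
    case (1 a)
    consider "underS r a = {}" | b where "immediate_pred r b a"
      | "underS r a \<noteq> {}" "\<nexists>b. immediate_pred r b a" by blast
    then show ?case
    proof cases
      case 1
      then show ?thesis using G_level_one[OF r] by auto
    next
      case 2
      then have "b \<in> underS r a" by (simp add: immediate_pred_def)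
      then show ?thesis
        using 1[of b] unfolding G_level_succ[OF r 2] by (fastforce simp: image_uf_plim)
    next
      case 3
      then show ?thesis using 1 unfolding G_level_limit[OF r 3] by blast
    qed
  qed
  then show ?thesis using assms(2) by blast
qed

text \<open>A point of level \<open>a\<close> is not a limit of countably many other points none of which lies in an
  earlier level. Those \<open>v\<close> that contain a fibre \<open>D n\<close> are separated from \<open>u\<close> fibrewise by
  the induction hypothesis.\<close>

lemma G_level_separated:
  assumes p: "selective p" and r: "Well_order r" and V: "countable V"
    and "u \<in> G_level r p a" "u \<notin> V"
    and "\<And>v b. v \<in> V \<Longrightarrow> b \<in> underS r a \<Longrightarrow> v \<notin> G_level r p b"
  shows "\<exists>B\<in>members u. \<forall>v\<in>V. B \<notin> members v"
proof -
  interpret wo_rel r by (rule wo_rel.intro[OF r])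
  have "\<forall>u\<in>G_level r p a - V. (\<forall>v\<in>V. \<forall>b\<in>underS a. v \<notin> G_level r p b) \<longrightarrow>
      (\<exists>B\<in>members u. \<forall>v\<in>V. B \<notin> members v)" for a
  proof (induction a rule: underS_induct[OF r])
    case (1 a)
    show ?case
    proof (intro ballI impI)
      fix u assume "u \<in> G_level r p a - V"
      then have u: "u \<in> G_level r p a" "u \<notin> V" by auto
      assume low: "\<forall>v\<in>V. \<forall>b\<in>underS a. v \<notin> G_level r p b"
      have IH: "\<exists>B\<in>members u'. \<forall>v\<in>V. B \<notin> members v"
        if b: "b \<in> underS a" "u' \<in> G_level r p b" for u' b
      proof -
        have "c \<in> underS a" if "c \<in> underS b" for c
          using that b TRANS ANTISYM by (auto simp: underS_def trans_def antisym_def)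
        then show ?thesis using 1[OF b(1)] b low by blast
      qed
      from r u(1) show "\<exists>B\<in>members u. \<forall>v\<in>V. B \<notin> members v"
      proof (cases rule: G_level_cases)
        case (principal x)
        then have "{x} \<notin> members v" if "v \<in> V" for v
          using that u(2) principal_if_singleton by blast
        then show ?thesis using principal by (intro bexI[of _ "{x}"]) auto
      next
        case (lower b)
        then show ?thesis using IH by blast
      next
        case (plim f b)
        show ?thesis
        proof (cases "{n. f n = u} \<in> members p")
          case True
          \<comment> \<open>In the constant case \<open>u\<close> itself already lies in the earlier
            level.\<close>
          then obtain n where "f n = u" using members_nonempty by blast
          then show ?thesis using IH[OF plim(2), of u] plim(3)[of n] by simp
        next
          case False
          then obtain D where D: "disjoint_family D" "{n. D n \<in> members (f n)} \<in> members p"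
            using plim_disjoint_family[OF p, of f] plim(1) by blast
          define V' where "V' = {v\<in>V. \<forall>n. D n \<notin> members v}"
          have "\<exists>B\<in>members (plim p f). \<forall>v\<in>V'. B \<notin> members v"
            by (rule plim_separated_off_fibres[OF p _ _ D(2)])
              (use V u(2) plim(1) in \<open>auto simp: V'_def\<close>)
          then obtain B where B: "B \<in> members u" "\<And>v. v \<in> V' \<Longrightarrow> B \<notin> members v"
            using plim(1) by blast
          have "\<exists>C. C \<in> members (f n) \<and> (\<forall>v\<in>V. C \<notin> members v)" for n
            using IH[OF plim(2,3)] by blast
          then obtain C where C: "\<And>n. C n \<in> members (f n)"
              "\<And>n v. v \<in> V \<Longrightarrow> C n \<notin> members v" by metis
          \<comment> \<open>\<open>?U\<close> excludes the members of \<open>V\<close> that contain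
            a fibre; \<open>B\<close> excludes the remaining ones.\<close>
          let ?U = "\<Union>n. C n \<inter> D n"
          have "?U \<in> members u"
            unfolding plim(1) by (rule UN_members_plim) (use C(1) D(2) in simp)
          moreover have "?U \<notin> members v" if "v \<in> V - V'" for v
          proof -
            obtain n where "D n \<in> members v" using \<open>v \<in> V - V'\<close> by (auto simp: V'_def)
            then have "?U \<in> members v \<longleftrightarrow> C n \<inter> D n \<in> members v"
              by (intro UN_disjoint_members_iff[OF D(1)]) auto
            then show ?thesis using C(2) that by simp
          qed
          ultimately show ?thesis using B by (intro bexI[of _ "B \<inter> ?U"]) auto
        qed
      qed
    qed
  qed
  then show ?thesis using assms by blast
qed

section \<open>Cancellation\<close>

text \<open>All translates of \<open>w\<close> have the same least level, so none is a limit of the others.\<close>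

lemma translate_separated:
  assumes p: "selective p" and w: "w \<in> hierarchy p"
  shows "\<exists>B\<in>members (principal_uf x + w). \<forall>y. y \<noteq> x \<longrightarrow> B \<notin> members (principal_uf y + w)"
proof -
  interpret wo_rel ordinals by (rule wo_rel.intro[OF ordinals_Well_order])
  note wo = ordinals_Well_order
  have "\<exists>a. w \<in> G_level ordinals p a" using w by (auto simp: hierarchy_def)
  then obtain a where a: "w \<in> G_level ordinals p a"
      "\<And>b. b \<in> underS a \<Longrightarrow> w \<notin> G_level ordinals p b"
  \<comment> \<open>Without a least level containing \<open>w\<close>, induction along the
    well-order would keep \<open>w\<close> out of every level.\<close>
  proof (rule contrapos_pp)
    assume none: "\<not> thesis"
    have "w \<notin> G_level ordinals p a" for a
      by (induction a rule: underS_induct[OF wo]) (use none that in blast)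
    then show "\<nexists>a. w \<in> G_level ordinals p a" by blast
  qed
  have "principal_uf x + w \<in> G_level ordinals p a"
    unfolding principal_plus by (rule image_uf_G_level[OF wo a(1)])
  moreover have "principal_uf y + w \<notin> G_level ordinals p b" if "b \<in> underS a" for y b
    using image_uf_G_level[OF wo, of "principal_uf y + w" p b "\<lambda>n. n - y"] a(2)[OF that]
    unfolding image_diff_principal_plus by blast
  ultimately have "\<exists>B\<in>members (principal_uf x + w).
      \<forall>v\<in>(\<lambda>y. principal_uf y + w) ` (- {x}). B \<notin> members v"
    by (intro G_level_separated[OF p wo]) (auto dest: principal_plus_inject)
  then show ?thesis by auto
qed

text \<open>Discreteness of the translates of \<open>w\<close> yields disjoint sets
  \<open>D x\<close>, one in each translate. These label the translates, and the labels recover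
  \<open>u\<close> from \<open>u + w\<close>.\<close>

lemma hierarchy_right_cancel:
  assumes p: "selective p" and w: "w \<in> hierarchy p" and eq: "u + w = v + w"
  shows "u = v"
proof -
  obtain B where B: "\<And>x. B x \<in> members (principal_uf x + w)"
      "\<And>x y. y \<noteq> x \<Longrightarrow> B x \<notin> members (principal_uf y + w)"
    using translate_separated[OF p w] by metis
  define D where "D x = B x - (\<Union>y<x. B y)" for x
  have "D m \<inter> D n = {}" if "m < n" for m n using that by (auto simp: D_def)
  then have disj: "disjoint_family D"
    unfolding disjoint_family_on_def by (metis inf_commute linorder_neqE_nat)
  have D: "D x \<in> members (principal_uf x + w)" for x
    using B by (simp add: D_def UN_members_iff)
  have key: "(\<Union>x\<in>A. D x) \<in> members (u + w) \<longleftrightarrow> A \<in> members u" for A u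
  proof -
    let ?C = "\<lambda>x. if x \<in> A then D x else {}"
    have U: "(\<Union>x\<in>A. D x) = (\<Union>x. ?C x)" by (auto split: if_splits)
    have "(\<Union>x. ?C x) \<in> members (principal_uf x + w) \<longleftrightarrow> ?C x \<in> members (principal_uf x + w)" for x
      by (rule UN_disjoint_members_iff[OF disj D]) auto
    then have "{y. x + y \<in> (\<Union>x\<in>A. D x)} \<in> members w \<longleftrightarrow> x \<in> A" for x
      using D[of x] unfolding U[symmetric] by (simp add: members_plus)
    then show ?thesis by (simp add: members_plus)
  qed
  show ?thesis by (rule beta_omega_eqI) (metis key eq)
qed

lemma principal_left_cancel: "principal_uf x + v = principal_uf x + w \<Longrightarrow> v = w"
  by (metis image_diff_principal_plus)

lemma hierarchy_left_cancel:
  assumes p: "selective p" and "u \<in> hierarchy p"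
    and v: "v \<in> hierarchy p" and w: "w \<in> hierarchy p" and "u + v = u + w"
  shows "v = w"
  using assms(2,5)
proof (induction u rule: hierarchy_induct)
  case (principal x)
  then show ?case by (rule principal_left_cancel)
next
  case (plim f)
  show ?case
  proof (cases "{n. f n = plim p f} \<in> members p")
    case True
    then obtain n where "f n = plim p f" using members_nonempty by blast
    then show ?thesis using plim by metis
  next
    case False
    \<comment> \<open>Right cancellation turns a term equal to the limit of the sums into a term of
      \<open>f\<close> equal to \<open>plim p f\<close>.\<close>
    have nonconst: "{n. f n + z = plim p (\<lambda>n. f n + z)} \<notin> members p" if "z \<in> hierarchy p" for z
    proof -
      have "f n + z = plim p (\<lambda>n. f n + z) \<longleftrightarrow> f n = plim p f" for n
        unfolding plus_plim[symmetric] by (auto dest: hierarchy_right_cancel[OF p that])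
      then show ?thesis using False by simp
    qed
    have "{n. f n + v = f n + w} \<in> members p"
      by (rule plim_eq_imp_eventually_eq[OF p _ nonconst[OF v] nonconst[OF w]])
        (use plim.prems in \<open>simp add: plus_plim\<close>)
    then obtain n where "f n + v = f n + w" using members_nonempty by blast
    then show ?thesis by (rule plim.IH)
  qed
qed

text \<open>Translation keeps \<open>v\<close> in its level, and addition commutes with limits in
  the left summand.\<close>

lemma hierarchy_plus_closed:
  assumes "u \<in> hierarchy p" "v \<in> hierarchy p"
  shows "u + v \<in> hierarchy p"
  using assms(1)
proof (induction u rule: hierarchy_induct)
  case (principal x)
  obtain a where "a \<in> Field ordinals" "v \<in> G_level ordinals p a"
    using assms(2) by (auto simp: hierarchy_def)
  then show ?case
    using image_uf_G_level[OF ordinals_Well_order] unfolding hierarchy_def principal_plus by blast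
next
  case (plim f)
  then show ?case unfolding plus_plim by (intro plim_in_hierarchy)
qed

theorem theorem3p20:
  fixes p :: beta_omega
  assumes "selective p"
  shows "hierarchy p \<noteq> {} \<and>
    (\<forall>u \<in> hierarchy p. \<forall>v \<in> hierarchy p. u + v \<in> hierarchy p) \<and>
    (\<forall>u \<in> hierarchy p. \<forall>v \<in> hierarchy p. \<forall>w \<in> hierarchy p. u + w = v + w \<longrightarrow> u = v) \<and>
    (\<forall>u \<in> hierarchy p. \<forall>v \<in> hierarchy p. \<forall>w \<in> hierarchy p. u + v = u + w \<longrightarrow> v = w)"
  using principal_in_hierarchy hierarchy_plus_closed hierarchy_right_cancel[OF assms]
    hierarchy_left_cancel[OF assms] by blast

end
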